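(* For each positive integer $n$, there are exactly $n$ pairwise non-isomorphic $\mathbf{I}_{2,0}$-chains of size $n$.
   Context: A zroupoid is an algebra $\mathbf A=\langle A,\to,0\rangle$ with a binary operation $\to$ and a constant $0$; write $x':=x\to 0$. An implication zroupoid is a zroupoid satisfying (I) $(x\to y)\to z\approx[(z'\to x)\to(y\to z)']'$ and $0''\approx 0$. $\mathbf{I}_{2,0}$ is the variety of implication zroupoids additionally satisfying $x''\approx x$. For such an algebra define $x\sqsubseteq y$ iff $(x\to y')'=x$ (this is a partial order on members of $\mathbf{I}_{2,0}$). An $\mathbf{I}_{2,0}$-chain is an algebra $\mathbf A\in\mathbf{I}_{2,0}$ on which $\sqsubseteq$ is a total order. Isomorphism means isomorphism of algebras $\langle A,\to,0\rangle$. *)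

theory Defs
  imports Main
begin

record 'a zroupoid =
  carrier :: "'a set"
  imp :: "'a \<Rightarrow> 'a \<Rightarrow> 'a"  (infixr "\<rightarrow>\<index>" 65)
  zero :: 'a  ("\<zero>\<index>")

definition neg :: "'a zroupoid \<Rightarrow> 'a \<Rightarrow> 'a" where
  "neg A x = imp A x (zero A)"

locale zroupoid =
  fixes A :: "'a zroupoid" (structure)
  assumes imp_closed: "\<lbrakk>x \<in> carrier A; y \<in> carrier A\<rbrakk> \<Longrightarrow> x \<rightarrow> y \<in> carrier A"
    and zero_closed: "\<zero> \<in> carrier A"

locale implication_zroupoid = zroupoid +
  assumes I: "\<lbrakk>x \<in> carrier A; y \<in> carrier A; z \<in> carrier A\<rbrakk> \<Longrightarrow>
      (x \<rightarrow> y) \<rightarrow> z = neg A ((neg A z \<rightarrow> x) \<rightarrow> neg A (y \<rightarrow> z))"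
    and neg_neg_zero: "neg A (neg A \<zero>) = \<zero>"

locale I20 = implication_zroupoid +
  assumes neg_neg: "x \<in> carrier A \<Longrightarrow> neg A (neg A x) = x"

definition sqle_rel :: "'a zroupoid \<Rightarrow> ('a \<times> 'a) set" where
  "sqle_rel A = {(x, y). x \<in> carrier A \<and> y \<in> carrier A \<and> neg A (imp A x (neg A y)) = x}"

locale I20_chain = I20 +
  assumes linear_sqle: "linear_order_on (carrier A) (sqle_rel A)"

definition zroupoid_isomorphic :: "'a zroupoid \<Rightarrow> 'b zroupoid \<Rightarrow> bool"  (infix "\<cong>" 50) where
  "A \<cong> B \<longleftrightarrow> (\<exists>h. bij_betw h (carrier A) (carrier B) \<and>
      (\<forall>x \<in> carrier A. \<forall>y \<in> carrier A. h (imp A x y) = imp B (h x) (h y)) \<and>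
      h (zero A) = zero B)"

end

theory Submission
  imports Defs
begin

text \<open>
  In a chain, an element \<open>x\<close> strictly below \<open>0\<close> satisfies \<open>x' = x\<close> and is absorbing
  (\<open>x \<rightarrow> y = y \<rightarrow> x = x\<close>) for every \<open>y\<close> above it, whereas the elements above \<open>0\<close> form a Kleene chain:
  the negation reverses their order and \<open>x \<rightarrow> y\<close> is the maximum of \<open>x'\<close> and \<open>y\<close>. On a finite chain
  the order-reversing negation above \<open>0\<close> can only be the reflection, so the algebra is determined
  by its size \<open>n\<close> and the position \<open>k < n\<close> of \<open>0\<close>. Conversely every \<open>k < n\<close> occurs, and an
  isomorphism, which preserves the order, preserves the position of \<open>0\<close>.
\<close>

section \<open>Equational consequences of (I) with involutive negation\<close>

context I20
begin

lemma neg_closed: "x \<in> carrier A \<Longrightarrow> neg A x \<in> carrier A"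
  by (simp add: neg_def imp_closed zero_closed)

lemmas closed = imp_closed zero_closed neg_closed

lemma imp_zero: "x \<rightarrow> \<zero> = neg A x"
  by (simp add: neg_def)

lemma neg_eq_iff: "x \<in> carrier A \<Longrightarrow> y \<in> carrier A \<Longrightarrow> neg A x = neg A y \<longleftrightarrow> x = y"
  by (metis neg_neg)

text \<open>At \<open>y = z = 0\<close>, (I) collapses to
  \<open>x'' = (0' \<rightarrow> x)''\<close>. Thus \<open>0'\<close>, called one in the names
  below, is a left unit.\<close>

lemma unit_imp:
  assumes x: "x \<in> carrier A"
  shows "neg A \<zero> \<rightarrow> x = x"
proof -
  have "neg A (x \<rightarrow> \<zero>) = neg A ((neg A \<zero> \<rightarrow> x) \<rightarrow> \<zero>)"
    using I[OF x zero_closed zero_closed] x neg_neg[OF zero_closed] by (simp add: imp_zero closed)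
  then show ?thesis
    using x by (simp add: imp_zero neg_eq_iff neg_neg closed)
qed

text \<open>This is (I) with \<open>0\<close> as its first variable, since
  \<open>z' \<rightarrow> 0\<close> is \<open>z\<close>.\<close>

lemma neg_imp_neg_imp:
  assumes "y \<in> carrier A" "z \<in> carrier A"
  shows "neg A (z \<rightarrow> neg A (y \<rightarrow> z)) = (\<zero> \<rightarrow> y) \<rightarrow> z"
  using I[OF zero_closed assms] assms by (simp add: imp_zero neg_neg)

lemma zero_imp_imp_one:
  assumes "y \<in> carrier A"
  shows "(\<zero> \<rightarrow> y) \<rightarrow> neg A \<zero> = y \<rightarrow> neg A \<zero>"
  using neg_imp_neg_imp[OF assms neg_closed[OF zero_closed]] assms
  by (simp add: unit_imp neg_neg closed)

lemma zero_imp_one: "\<zero> \<rightarrow> neg A \<zero> = neg A \<zero>"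
  using zero_imp_imp_one[OF zero_closed] zero_imp_imp_one[OF neg_closed[OF zero_closed]]
  by (simp add: unit_imp imp_zero closed)

lemma neg_imp_one:
  assumes "x \<in> carrier A"
  shows "neg A x \<rightarrow> neg A \<zero> = \<zero> \<rightarrow> x"
  using I[OF assms zero_closed neg_closed[OF zero_closed]] assms
  by (simp add: imp_zero zero_imp_one neg_neg closed)

lemma neg_imp_self:
  assumes "x \<in> carrier A"
  shows "neg A x \<rightarrow> x = x"
  using neg_imp_neg_imp[OF neg_closed[OF zero_closed] neg_closed[OF assms]] assms
  by (simp add: unit_imp zero_imp_one neg_neg neg_eq_iff closed)

text \<open>The hypotheses spell out \<open>x \<sqsubseteq> 0\<close>,
  \<open>x' \<sqsubseteq> 0\<close> and \<open>x \<sqsubseteq> x'\<close>. They give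
  \<open>0 \<rightarrow> x = x\<close>, so \<open>neg_imp_neg_imp\<close> with both variables
  \<open>x\<close> reads \<open>x = x'\<close>.\<close>

lemma fixed_of_below_zero:
  assumes x: "x \<in> carrier A"
    and "x \<rightarrow> neg A \<zero> = neg A x" "neg A x \<rightarrow> neg A \<zero> = x" "x \<rightarrow> x = neg A x"
  shows "neg A x = x"
  using neg_imp_neg_imp[OF x x] neg_imp_one[OF x] assms by (simp add: neg_neg)

text \<open>The instances of (I) at \<open>(x, y, x)\<close> and \<open>(0', y, x)\<close> have the
  same right-hand side, so \<open>x \<rightarrow> x\<close> and \<open>y \<rightarrow> x\<close>
  coincide.\<close>

lemma imp_absorb:
  assumes x: "x \<in> carrier A" and y: "y \<in> carrier A"
    and "x \<rightarrow> neg A \<zero> = x" "neg A x = x" "x \<rightarrow> y = x"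
  shows "y \<rightarrow> x = x"
proof -
  have xx: "x \<rightarrow> x = x"
    using neg_imp_self[OF x] assms by simp
  have "x \<rightarrow> x = neg A (x \<rightarrow> neg A (y \<rightarrow> x))"
    using I[OF x y x] assms xx by simp
  moreover have "y \<rightarrow> x = neg A (x \<rightarrow> neg A (y \<rightarrow> x))"
    using I[OF neg_closed[OF zero_closed] y x] assms by (simp add: unit_imp)
  ultimately show ?thesis using xx by simp
qed

text \<open>Makes lying above \<open>0\<close> invariant under negation:
  \<open>0 \<rightarrow> x\<close> equals \<open>x' \<rightarrow> 0'\<close>, which equals
  \<open>(0 \<rightarrow> x') \<rightarrow> 0'\<close>.\<close>

lemma zero_imp_of_neg:
  assumes x: "x \<in> carrier A" and "\<zero> \<rightarrow> neg A x = neg A \<zero>"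
  shows "\<zero> \<rightarrow> x = neg A \<zero>"
  using zero_imp_imp_one[OF neg_closed[OF x]] neg_imp_one[OF x] assms
  by (simp add: unit_imp closed)

text \<open>For \<open>0 \<sqsubseteq> x \<sqsubseteq> y\<close>, here in equational form,
  \<open>y' \<rightarrow> x\<close> acts as the join of \<open>y\<close> and \<open>x\<close>:
  \<open>neg_imp_neg_imp\<close> at \<open>x\<close> and \<open>y'\<close> reads
  \<open>(y' \<rightarrow> x)' = y'\<close>.\<close>

lemma neg_imp_absorb:
  assumes x: "x \<in> carrier A" and y: "y \<in> carrier A"
    and "\<zero> \<rightarrow> x = neg A \<zero>" "x \<rightarrow> neg A y = neg A x"
  shows "neg A y \<rightarrow> x = y"
  using neg_imp_neg_imp[OF x neg_closed[OF y]] assms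
  by (simp add: unit_imp neg_neg neg_eq_iff closed)

text \<open>Commutativity of that join: in (I) with middle variable \<open>0\<close>, the factor
  \<open>(0 \<rightarrow> y)'\<close> becomes \<open>0\<close>.\<close>

lemma neg_imp_swap:
  assumes x: "x \<in> carrier A" and y: "y \<in> carrier A"
    and "\<zero> \<rightarrow> y = neg A \<zero>"
  shows "neg A x \<rightarrow> y = neg A y \<rightarrow> x"
  using I[OF x zero_closed y] assms
  by (simp add: imp_zero neg_neg closed)

end

section \<open>Ranks in finite linear orders\<close>

lemma linear_order_on_index:
  assumes lin: "linear_order_on C r" and fin: "finite C"
  shows "\<exists>h. bij_betw h C {..<card C} \<and> (\<forall>x\<in>C. \<forall>y\<in>C. (x, y) \<in> r \<longleftrightarrow> h x \<le> h y)"
proof -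
  \<comment> \<open>The rank of \<open>x\<close>, counted from 0.\<close>
  define h where "h x = card {y \<in> C. (y, x) \<in> r \<and> y \<noteq> x}" for x
  have tr: "trans r" and an: "antisym r" and re: "\<And>x. x \<in> C \<Longrightarrow> (x, x) \<in> r"
    and tot: "total_on C r"
    using lin by (auto simp: order_on_defs refl_on_def)
  have less: "h x < h y" if "x \<in> C" "y \<in> C" "(x, y) \<in> r" "x \<noteq> y" for x y
  proof -
    have "{z \<in> C. (z, x) \<in> r \<and> z \<noteq> x} \<subset> {z \<in> C. (z, y) \<in> r \<and> z \<noteq> y}"
      using that transD[OF tr] antisymD[OF an] by blast
    then show ?thesis
      unfolding h_def using fin by (intro psubset_card_mono) auto
  qed
  have le: "(x, y) \<in> r \<longleftrightarrow> h x \<le> h y" if "x \<in> C" "y \<in> C" for x y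
    using that less[of x y] less[of y x] re tot unfolding total_on_def
    by (metis leD less_imp_le order_refl)
  have inj: "inj_on h C"
    by (rule inj_onI) (metis an antisymD le order_refl)
  have "h x < card C" if "x \<in> C" for x
    unfolding h_def using fin that by (intro psubset_card_mono) auto
  then have "h ` C = {..<card C}"
    using card_image[OF inj] by (intro card_subset_eq) auto
  then show ?thesis
    using inj le by (auto simp: bij_betw_def)
qed

section \<open>The model chains\<close>

text \<open>\<open>k\<close> is the position of the zero. The term \<open>n - 1 + k - x\<close>
  reflects the interval from \<open>k\<close> to \<open>n - 1\<close>, swapping its ends; on the
  carrier the subtraction never truncates.\<close>

definition chain_zroupoid :: "nat \<Rightarrow> nat \<Rightarrow> nat zroupoid" where
  "chain_zroupoid n k = \<lparr>carrier = {..<n},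
     imp = (\<lambda>x y. if x < k \<or> y < k then min x y else max (n - 1 + k - x) y), zero = k\<rparr>"

lemma carrier_chain_zroupoid: "carrier (chain_zroupoid n k) = {..<n}"
  and zero_chain_zroupoid: "zero (chain_zroupoid n k) = k"
  and imp_chain_zroupoid: "imp (chain_zroupoid n k) x y =
    (if x < k \<or> y < k then min x y else max (n - 1 + k - x) y)"
  by (simp_all add: chain_zroupoid_def)

lemma neg_chain_zroupoid:
  assumes "k < n" "x < n"
  shows "neg (chain_zroupoid n k) x = (if x < k then x else n - 1 + k - x)"
  using assms by (auto simp: neg_def imp_chain_zroupoid zero_chain_zroupoid)

lemma imp_closed_chain_zroupoid:
  "k < n \<Longrightarrow> x < n \<Longrightarrow> y < n \<Longrightarrow> imp (chain_zroupoid n k) x y < n"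
  by (auto simp: imp_chain_zroupoid)

text \<open>In every case \<open>(x \<rightarrow> y')'\<close> evaluates to \<open>min x y\<close>:
  from \<open>k\<close> on by De Morgan, otherwise because negation fixes what is below
  \<open>k\<close>.\<close>

lemma sqle_rel_chain_zroupoid:
  assumes "k < n"
  shows "sqle_rel (chain_zroupoid n k) = {(x, y). x < n \<and> y < n \<and> x \<le> y}"
proof -
  have "neg (chain_zroupoid n k) (imp (chain_zroupoid n k) x (neg (chain_zroupoid n k) y)) = x
      \<longleftrightarrow> x \<le> y" if "x < n" "y < n" for x y
  proof -
    have "neg (chain_zroupoid n k) y < n"
      using that assms by (auto simp: neg_chain_zroupoid)
    then show ?thesis
      using that assms by (auto simp: neg_chain_zroupoid imp_closed_chain_zroupoid imp_chain_zroupoid)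
  qed
  then show ?thesis
    by (auto simp: sqle_rel_def carrier_chain_zroupoid)
qed

text \<open>Truncation at \<open>k\<close> is a homomorphism onto a semilattice with trivial negation; since the
  identity (I) is regular, this already settles it whenever some argument is below \<open>k\<close>.\<close>

lemma min_imp_chain_zroupoid:
  "k < n \<Longrightarrow> x < n \<Longrightarrow> min (imp (chain_zroupoid n k) x y) k = min (min x k) (min y k)"
  by (auto simp: imp_chain_zroupoid)

lemma min_neg_chain_zroupoid:
  "k < n \<Longrightarrow> x < n \<Longrightarrow> min (neg (chain_zroupoid n k) x) k = min x k"
  by (auto simp: neg_chain_zroupoid)

lemma diff_max:
  fixes m a b :: nat
  shows "m - max a b = min (m - a) (m - b)"
  by (auto simp: min_def max_def)

lemma I20_chain_chain_zroupoid:
  assumes k: "k < n"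
  shows "I20_chain (chain_zroupoid n k)"
proof
  let ?B = "chain_zroupoid n k"
  note simps = neg_chain_zroupoid imp_chain_zroupoid zero_chain_zroupoid carrier_chain_zroupoid
  show "zero ?B \<in> carrier ?B" and "neg ?B (neg ?B (zero ?B)) = zero ?B"
    using k by (auto simp: simps)
  show "imp ?B x y \<in> carrier ?B" if "x \<in> carrier ?B" "y \<in> carrier ?B" for x y
    using that k by (simp add: imp_closed_chain_zroupoid carrier_chain_zroupoid)
  show "neg ?B (neg ?B x) = x" if "x \<in> carrier ?B" for x
    using that k by (auto simp: simps)
  show "imp ?B (imp ?B x y) z = neg ?B (imp ?B (imp ?B (neg ?B z) x) (neg ?B (imp ?B y z)))"
    if "x \<in> carrier ?B" "y \<in> carrier ?B" "z \<in> carrier ?B" for x y z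
  proof -
    have lt: "x < n" "y < n" "z < n" using that by (auto simp: carrier_chain_zroupoid)
    have negs: "neg ?B u < n" if "u < n" for u
      using that k by (auto simp: neg_chain_zroupoid)
    show ?thesis
    proof (cases "x < k \<or> y < k \<or> z < k")
      case True
      let ?l = "imp ?B (imp ?B x y) z"
      let ?r = "neg ?B (imp ?B (imp ?B (neg ?B z) x) (neg ?B (imp ?B y z)))"
      have l: "min ?l k = min (min (min x k) (min y k)) (min z k)"
        using lt k by (simp add: min_imp_chain_zroupoid imp_closed_chain_zroupoid del: min.assoc)
      have r: "min ?r k = min (min (min z k) (min x k)) (min (min y k) (min z k))"
        using lt k by (simp add: min_imp_chain_zroupoid min_neg_chain_zroupoid
            imp_closed_chain_zroupoid negs del: min.assoc)
      have "min ?l k = min ?r k"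
        unfolding l r by (simp add: ac_simps)
      \<comment> \<open>A truncated value below \<open>k\<close> is the value itself, so equal
        truncations force equal sides.\<close>
      moreover have "min ?l k < k"
        unfolding l using True by auto
      ultimately show ?thesis
        by (metis min_def order_less_irrefl)
    next
      case False
      \<comment> \<open>From \<open>k\<close> on negation is \<open>m - u\<close>, and (I) reduces
        to De Morgan and distributivity; \<open>a\<close> and \<open>b\<close> will be the inner
        terms \<open>z' \<rightarrow> x\<close> and \<open>y \<rightarrow> z\<close> of its
        right-hand side.\<close>
      define m where "m = n - 1 + k"
      have le: "x \<le> m" "y \<le> m" "z \<le> m"
        using lt unfolding m_def by linarith+
      have neg: "neg ?B u = m - u" and neg_ge: "k \<le> m - u" if "k \<le> u" "u < n" for u
        using that k by (simp_all add: neg_chain_zroupoid m_def)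
      have imp: "imp ?B u v = max (m - u) v" if "k \<le> u" "k \<le> v" for u v
        using that by (simp add: imp_chain_zroupoid m_def)
      have xyz: "k \<le> x" "k \<le> y" "k \<le> z" using False by auto
      define a where "a = imp ?B (neg ?B z) x"
      define b where "b = imp ?B y z"
      have nz: "neg ?B z = m - z" "k \<le> m - z"
        using xyz lt by (simp_all only: neg neg_ge)
      have a: "a = max z x" "k \<le> a"
        unfolding a_def nz(1) imp[OF nz(2) xyz(1)] using le xyz by simp_all
      have b: "b = max (m - y) z" "k \<le> b"
        unfolding b_def imp[OF xyz(2,3)] using xyz by simp_all
      have "b < n"
        using imp_closed_chain_zroupoid[OF k lt(2,3)] by (simp add: b_def)
      then have nb: "neg ?B b = m - b" "k \<le> m - b"
        using b by (simp_all only: neg neg_ge)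
      have "imp ?B a (neg ?B b) < n"
        unfolding a_def using k lt \<open>b < n\<close> by (intro imp_closed_chain_zroupoid negs) simp_all
      then have "neg ?B (imp ?B a (neg ?B b)) = m - max (m - a) (m - b)"
        using neg[of "imp ?B a (neg ?B b)"] imp[OF a(2) nb(2)] nb by (simp add: le_max_iff_disj)
      also have "\<dots> = min (m - (m - a)) (m - (m - b))"
        by (rule diff_max)
      also have "\<dots> = min a b"
        using le a(1) b(1) by simp
      \<comment> \<open>Distributivity: \<open>z\<close> is a common argument of the two
        maxima.\<close>
      also have "\<dots> = max (min x (m - y)) z"
        unfolding a(1) b(1)
        by (simp add: min_def max_def)
      also have "\<dots> = max (m - max (m - x) y) z"
        using le by (simp add: diff_max)
      also have "\<dots> = imp ?B (imp ?B x y) z"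
      proof -
        have c: "imp ?B x y = max (m - x) y" by (rule imp[OF xyz(1,2)])
        have "k \<le> imp ?B x y" unfolding c using xyz by simp
        then show ?thesis using imp[of "imp ?B x y" z] xyz(3) c by simp
      qed
      finally show ?thesis by (simp add: a_def b_def)
    qed
  qed
  show "linear_order_on (carrier ?B) (sqle_rel ?B)"
    by (auto simp: sqle_rel_chain_zroupoid[OF k] carrier_chain_zroupoid order_on_defs
        refl_on_def total_on_def intro!: transI antisymI)
qed

section \<open>Isomorphisms and the order\<close>

text \<open>The order is given by an equation between terms, which an injective homomorphism
  preserves and reflects.\<close>

lemma iso_sqle_rel_iff:
  assumes "zroupoid A" and bij: "bij_betw h (carrier A) (carrier B)"
    and imp: "\<And>x y. x \<in> carrier A \<Longrightarrow> y \<in> carrier A \<Longrightarrow> h (imp A x y) = imp B (h x) (h y)"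
    and zero: "h (zero A) = zero B"
    and xy: "x \<in> carrier A" "y \<in> carrier A"
  shows "(h x, h y) \<in> sqle_rel B \<longleftrightarrow> (x, y) \<in> sqle_rel A"
proof -
  interpret zroupoid A by fact
  have neg: "h (neg A u) = neg B (h u)" "neg A u \<in> carrier A" if "u \<in> carrier A" for u
    using that by (simp_all add: neg_def imp zero imp_closed zero_closed)
  have "neg B (imp B (h x) (neg B (h y))) = h (neg A (imp A x (neg A y)))"
    using xy by (simp add: neg imp imp_closed)
  moreover have "h (neg A (imp A x (neg A y))) = h x \<longleftrightarrow> neg A (imp A x (neg A y)) = x"
    using xy by (intro inj_on_eq_iff[OF bij_betw_imp_inj_on[OF bij]]) (simp_all add: neg imp_closed)
  moreover have "h x \<in> carrier B" "h y \<in> carrier B"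
    using xy bij by (auto simp: bij_betw_def)
  ultimately show ?thesis
    using xy by (simp add: sqle_rel_def)
qed

text \<open>The isomorphism is an order automorphism of \<open>{..<n}\<close> sending
  \<open>j\<close> to \<open>k\<close>, so the down-sets of \<open>j\<close> and \<open>k\<close>
  have the same size.\<close>

lemma chain_zroupoid_isomorphicD:
  assumes iso: "chain_zroupoid n j \<cong> chain_zroupoid n k" and j: "j < n" and k: "k < n"
  shows "j = k"
proof -
  obtain h where bij: "bij_betw h {..<n} {..<n}" and h0: "h j = k"
    and imp: "\<And>x y. x < n \<Longrightarrow> y < n \<Longrightarrow>
      h (imp (chain_zroupoid n j) x y) = imp (chain_zroupoid n k) (h x) (h y)"
    using iso by (auto simp: zroupoid_isomorphic_def carrier_chain_zroupoid zero_chain_zroupoid)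
  interpret J: I20_chain "chain_zroupoid n j" by (rule I20_chain_chain_zroupoid[OF j])
  have mem: "h x < n" if "x < n" for x
    using that bij by (auto simp: bij_betw_def)
  have le: "h x \<le> h y \<longleftrightarrow> x \<le> y" if "x < n" "y < n" for x y
    using iso_sqle_rel_iff[OF J.zroupoid_axioms, of h "chain_zroupoid n k" x y] that bij h0 imp mem
    by (simp add: sqle_rel_chain_zroupoid j k carrier_chain_zroupoid zero_chain_zroupoid)
  have "h ` {..j} = {..k}"
  proof
    show "h ` {..j} \<subseteq> {..k}"
      using le[OF _ j] h0 j by auto
    show "{..k} \<subseteq> h ` {..j}"
    proof
      fix y assume y: "y \<in> {..k}"
      then obtain x where "x < n" "y = h x"
        using bij k unfolding bij_betw_def
        by (metis (no_types, lifting) atMost_iff imageE lessThan_iff order_le_less_trans)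
      then show "y \<in> h ` {..j}"
        using y le[OF _ j] h0 by auto
    qed
  qed
  moreover have "inj_on h {..j}"
    using bij j by (auto simp: bij_betw_def intro: inj_on_subset)
  ultimately show ?thesis
    using card_image[of h "{..j}"] by simp
qed

section \<open>Structure of an arbitrary chain\<close>

context I20_chain
begin

abbreviation sqle (infix "\<sqsubseteq>" 50) where
  "x \<sqsubseteq> y \<equiv> (x, y) \<in> sqle_rel A"

text \<open>Negating both sides of the defining equation gives the form in which the equational
  lemmas state their hypotheses.\<close>

lemma sqle_iff:
  "x \<in> carrier A \<Longrightarrow> y \<in> carrier A \<Longrightarrow> x \<sqsubseteq> y \<longleftrightarrow> x \<rightarrow> neg A y = neg A x"
  unfolding sqle_rel_def using neg_eq_iff[of "x \<rightarrow> neg A y" "neg A x"]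
  by (simp add: closed neg_neg)

lemma sqle_trans: "x \<sqsubseteq> y \<Longrightarrow> y \<sqsubseteq> z \<Longrightarrow> x \<sqsubseteq> z"
  using linear_sqle by (auto simp: order_on_defs dest: transD)

lemma sqle_antisym: "x \<sqsubseteq> y \<Longrightarrow> y \<sqsubseteq> x \<Longrightarrow> x = y"
  using linear_sqle by (auto simp: order_on_defs dest: antisymD)

lemma sqle_refl: "x \<in> carrier A \<Longrightarrow> x \<sqsubseteq> x"
  using linear_sqle by (auto simp: order_on_defs refl_on_def)

lemma sqle_cases: "x \<in> carrier A \<Longrightarrow> y \<in> carrier A \<Longrightarrow> x \<sqsubseteq> y \<or> y \<sqsubseteq> x"
  using linear_sqle sqle_refl by (cases "x = y") (auto simp: order_on_defs total_on_def)

lemma zero_sqle_iff: "x \<in> carrier A \<Longrightarrow> \<zero> \<sqsubseteq> x \<longleftrightarrow> \<zero> \<rightarrow> x = neg A \<zero>"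
  using zero_imp_of_neg[of x] zero_imp_of_neg[of "neg A x"]
  by (auto simp: sqle_iff closed neg_neg)

lemma zero_sqle_neg: "x \<in> carrier A \<Longrightarrow> \<zero> \<sqsubseteq> x \<Longrightarrow> \<zero> \<sqsubseteq> neg A x"
  using zero_imp_of_neg[of "neg A x"] by (simp add: zero_sqle_iff closed neg_neg)

text \<open>\<open>x'\<close> cannot lie above \<open>0\<close>, or else \<open>x = x''\<close>
  would too. So \<open>x\<close> and \<open>x'\<close> are both below \<open>0\<close>, and
  \<open>fixed_of_below_zero\<close> applies to the smaller of them.\<close>

lemma neg_below_zero:
  assumes x: "x \<in> carrier A" and le: "x \<sqsubseteq> \<zero>" and ne: "x \<noteq> \<zero>"
  shows "neg A x = x"
proof -
  have fixed: "neg A u = u" if "u \<in> carrier A" "u \<sqsubseteq> \<zero>" "neg A u \<sqsubseteq> \<zero>" "u \<sqsubseteq> neg A u" for u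
    using that by (intro fixed_of_below_zero) (auto simp: sqle_iff closed neg_neg)
  have nx: "neg A x \<in> carrier A" by (rule neg_closed[OF x])
  have "\<not> \<zero> \<sqsubseteq> neg A x"
  proof
    assume "\<zero> \<sqsubseteq> neg A x"
    then have "\<zero> \<sqsubseteq> x" using zero_sqle_neg[OF nx] by (simp add: neg_neg x)
    then show False using le ne sqle_antisym by blast
  qed
  then have "neg A x \<sqsubseteq> \<zero>"
    using sqle_cases[OF nx zero_closed] by blast
  then show ?thesis
    using fixed[OF x le] fixed[OF nx] le sqle_cases[OF x nx] by (auto simp: neg_neg x)
qed

text \<open>\<open>x \<sqsubseteq> y'\<close> holds as well, since \<open>y'\<close> is either above
  \<open>0\<close> or equal to \<open>y\<close>; this is the first equation, and
  \<open>imp_absorb\<close> yields the second.\<close>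

lemma imp_below_zero:
  assumes x: "x \<in> carrier A" and y: "y \<in> carrier A"
    and le: "x \<sqsubseteq> \<zero>" "x \<noteq> \<zero>" "x \<sqsubseteq> y"
  shows "x \<rightarrow> y = x" "y \<rightarrow> x = x"
proof -
  have nx: "neg A x = x" by (rule neg_below_zero[OF x le(1,2)])
  have "x \<sqsubseteq> neg A y"
  proof (cases "\<zero> \<sqsubseteq> y")
    case True
    then show ?thesis using le zero_sqle_neg[OF y] sqle_trans by blast
  next
    case False
    then have "y \<sqsubseteq> \<zero>" "y \<noteq> \<zero>"
      using sqle_cases[OF y zero_closed] sqle_refl[OF zero_closed] by auto
    then show ?thesis using le neg_below_zero[OF y] by simp
  qed
  then show xy: "x \<rightarrow> y = x"
    using x y nx by (simp add: sqle_iff closed neg_neg)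
  show "y \<rightarrow> x = x"
    using le nx x xy y by (intro imp_absorb) (auto simp: sqle_iff closed)
qed

text \<open>\<open>neg_imp_absorb\<close> computes the join of \<open>x'\<close> and
  \<open>y\<close> when the smaller one stands on the right; if that is \<open>x'\<close>,
  \<open>neg_imp_swap\<close> exchanges the two.\<close>

lemma imp_above_zero:
  assumes x: "x \<in> carrier A" "\<zero> \<sqsubseteq> x" and y: "y \<in> carrier A" "\<zero> \<sqsubseteq> y"
  shows "x \<rightarrow> y = (if neg A x \<sqsubseteq> y then y else neg A x)"
proof (cases "neg A x \<sqsubseteq> y")
  case True
  have "neg A y \<rightarrow> neg A x = y"
    using True x y zero_sqle_iff[OF neg_closed[OF x(1)]] zero_sqle_neg[OF x]
    by (intro neg_imp_absorb) (simp_all add: sqle_iff[OF neg_closed[OF x(1)]] closed)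
  then show ?thesis
    using True neg_imp_swap[OF neg_closed[OF x(1)] y(1)] x y by (simp add: neg_neg zero_sqle_iff)
next
  case False
  then have "y \<sqsubseteq> neg A x" using sqle_cases x y closed by blast
  then have "neg A (neg A x) \<rightarrow> y = neg A x"
    using x y zero_sqle_iff[OF y(1)]
    by (intro neg_imp_absorb) (simp_all add: sqle_iff[OF y(1)] closed)
  then show ?thesis using False x by (simp add: neg_neg)
qed

text \<open>\<open>neg_imp_absorb\<close> gives \<open>y' \<rightarrow> x = y\<close>, which is
  \<open>y' \<sqsubseteq> x'\<close> written out by \<open>sqle_iff\<close>.\<close>

lemma neg_antimono:
  assumes "x \<in> carrier A" "\<zero> \<sqsubseteq> x" "y \<in> carrier A" "\<zero> \<sqsubseteq> y" "x \<sqsubseteq> y"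
  shows "neg A y \<sqsubseteq> neg A x"
proof -
  have "neg A y \<rightarrow> x = y"
    using assms zero_sqle_iff[OF assms(1)]
    by (intro neg_imp_absorb) (simp_all add: sqle_iff[OF assms(1)])
  then show ?thesis
    using assms by (simp add: sqle_iff closed neg_neg)
qed

section \<open>Classification of finite chains\<close>

lemma isomorphic_chain_zroupoid:
  assumes fin: "finite (carrier A)"
  shows "\<exists>k < card (carrier A). A \<cong> chain_zroupoid (card (carrier A)) k"
proof -
  define n where "n = card (carrier A)"
  obtain h where bij: "bij_betw h (carrier A) {..<n}"
    and le: "\<And>x y. x \<in> carrier A \<Longrightarrow> y \<in> carrier A \<Longrightarrow> x \<sqsubseteq> y \<longleftrightarrow> h x \<le> h y"
    using linear_order_on_index[OF linear_sqle fin] unfolding n_def by blast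
  define k where "k = h \<zero>"
  have lt: "h x < n" if "x \<in> carrier A" for x
    using bij that by (auto simp: bij_betw_def)
  have inj: "h x = h y \<longleftrightarrow> x = y" if "x \<in> carrier A" "y \<in> carrier A" for x y
    using bij that by (auto simp: bij_betw_def inj_on_eq_iff)
  have surj: "\<exists>x \<in> carrier A. h x = i" if "i < n" for i
    using bij that by (auto simp: bij_betw_def image_iff) (metis image_iff lessThan_iff)
  have k: "k < n" using lt zero_closed by (simp add: k_def)
  have above: "\<zero> \<sqsubseteq> x \<longleftrightarrow> k \<le> h x" if "x \<in> carrier A" for x
    using le[OF zero_closed that] by (simp add: k_def)
  have below: "x \<sqsubseteq> \<zero> \<and> x \<noteq> \<zero> \<longleftrightarrow> h x < k" if "x \<in> carrier A" for x
    using le[OF that zero_closed] inj[OF that zero_closed] by (auto simp: k_def)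
  \<comment> \<open>By counting: negation maps the interval \<open>U\<close> from \<open>0\<close>
    to \<open>x\<close> bijectively onto the elements above \<open>x'\<close>, so
    \<open>h x + 1 - k = n - h (neg A x)\<close>.\<close>
  have hneg: "h (neg A x) = n - 1 + k - h x" if x: "x \<in> carrier A" "k \<le> h x" for x
  proof -
    have ge: "k \<le> h (neg A x)"
      using zero_sqle_neg[OF x(1)] above x closed by simp
    define U where "U = {y \<in> carrier A. \<zero> \<sqsubseteq> y \<and> y \<sqsubseteq> x}"
    have x0: "\<zero> \<sqsubseteq> x" using x above by simp
    have "h ` U = {k..h x}"
    proof
      show "h ` U \<subseteq> {k..h x}"
        using x above le by (auto simp: U_def)
      show "{k..h x} \<subseteq> h ` U"
      proof
        fix i assume i: "i \<in> {k..h x}"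
        then obtain y where "y \<in> carrier A" "h y = i"
          using surj[of i] lt[OF x(1)] by auto
        then show "i \<in> h ` U" using i x above le by (auto simp: U_def)
      qed
    qed
    moreover have "(\<lambda>y. h (neg A y)) ` U = {h (neg A x)..<n}"
    proof
      show "(\<lambda>y. h (neg A y)) ` U \<subseteq> {h (neg A x)..<n}"
      proof
        fix i assume "i \<in> (\<lambda>y. h (neg A y)) ` U"
        then obtain y where y: "y \<in> carrier A" "\<zero> \<sqsubseteq> y" "y \<sqsubseteq> x" "i = h (neg A y)"
          by (auto simp: U_def)
        then show "i \<in> {h (neg A x)..<n}"
          using neg_antimono[OF y(1,2) x(1) x0 y(3)] le x(1) lt by (simp add: closed)
      qed
      show "{h (neg A x)..<n} \<subseteq> (\<lambda>y. h (neg A y)) ` U"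
      proof
        fix i assume i: "i \<in> {h (neg A x)..<n}"
        then obtain y where y: "y \<in> carrier A" "h y = i"
          using surj[of i] by auto
        have y0: "\<zero> \<sqsubseteq> y" using i ge y above by simp
        have "neg A x \<sqsubseteq> y" using i y le x(1) by (simp add: closed)
        then have "neg A y \<sqsubseteq> x"
          using neg_antimono[OF neg_closed[OF x(1)] zero_sqle_neg[OF x(1) x0] y(1) y0] x(1)
          by (simp add: neg_neg)
        then have "neg A y \<in> U"
          using y y0 zero_sqle_neg by (simp add: U_def closed)
        then show "i \<in> (\<lambda>y. h (neg A y)) ` U"
          using y by (force simp: neg_neg)
      qed
    qed
    moreover have "inj_on h U" "inj_on (\<lambda>y. h (neg A y)) U"
      by (auto simp: inj_on_def U_def inj closed neg_eq_iff)
    ultimately have "card {k..h x} = card {h (neg A x)..<n}"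
      using card_image[of h U] card_image[of "\<lambda>y. h (neg A y)" U] by simp
    then show ?thesis using x ge lt[OF x(1)] lt[OF neg_closed[OF x(1)]] by simp
  qed
  have "h (x \<rightarrow> y) = imp (chain_zroupoid n k) (h x) (h y)"
    if xy: "x \<in> carrier A" "y \<in> carrier A" for x y
  \<comment> \<open>If some argument is strictly below \<open>0\<close>, so is the smaller one, and
    it absorbs the other.\<close>
  proof (cases "h x < k \<or> h y < k")
    case True
    show ?thesis
    proof (cases "h x \<le> h y")
      case True': True
      then have "x \<sqsubseteq> \<zero> \<and> x \<noteq> \<zero>" "x \<sqsubseteq> y"
        using True below[OF xy(1)] le[OF xy] by linarith+
      then show ?thesis using True True' xy imp_below_zero(1) by (simp add: imp_chain_zroupoid)
    next
      case False
      then have "y \<sqsubseteq> \<zero> \<and> y \<noteq> \<zero>" "y \<sqsubseteq> x"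
        using True below[OF xy(2)] le[OF xy(2,1)] by linarith+
      then show ?thesis using True False xy imp_below_zero(2) by (simp add: imp_chain_zroupoid)
    qed
  next
    case False
    then show ?thesis
      using xy above by (auto simp: imp_above_zero le closed hneg imp_chain_zroupoid)
  qed
  then have "A \<cong> chain_zroupoid n k"
    unfolding zroupoid_isomorphic_def using bij
    by (intro exI[of _ h]) (simp add: carrier_chain_zroupoid zero_chain_zroupoid k_def)
  then show ?thesis using k n_def by blast
qed

end

text \<open>The representatives live over \<open>nat\<close>, because \<open>'a\<close> may have
  fewer than \<open>n\<close> elements.\<close>

theorem theorem5p14:
  fixes n :: nat
  assumes "n > 0"
  shows "\<exists>F :: nat zroupoid set.
      card F = n \<and>
      (\<forall>A \<in> F. I20_chain A \<and> card (carrier A) = n) \<and>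
      pairwise (\<lambda>A B. \<not> A \<cong> B) F \<and>
      (\<forall>B :: 'a zroupoid. I20_chain B \<and> card (carrier B) = n \<longrightarrow> (\<exists>A \<in> F. B \<cong> A))"
proof (intro exI conjI)
  let ?F = "chain_zroupoid n ` {..<n}"
  have "inj_on (chain_zroupoid n) {..<n}"
    by (rule inj_onI) (metis zero_chain_zroupoid)
  then show "card ?F = n" by (simp add: card_image)
  show "\<forall>A \<in> ?F. I20_chain A \<and> card (carrier A) = n"
    by (auto simp: I20_chain_chain_zroupoid carrier_chain_zroupoid)
  show "pairwise (\<lambda>A B. \<not> A \<cong> B) ?F"
    by (auto simp: pairwise_def dest: chain_zroupoid_isomorphicD)
  show "\<forall>B :: 'a zroupoid. I20_chain B \<and> card (carrier B) = n \<longrightarrow> (\<exists>A \<in> ?F. B \<cong> A)"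
  proof (intro allI impI)
    fix B :: "'a zroupoid"
    assume B: "I20_chain B \<and> card (carrier B) = n"
    \<comment> \<open>Infinite sets have \<open>card\<close> 0, so positivity of \<open>n\<close>
      excludes them.\<close>
    then have "finite (carrier B)" using assms by (simp add: card_ge_0_finite)
    then show "\<exists>A \<in> ?F. B \<cong> A"
      using I20_chain.isomorphic_chain_zroupoid[of B] B by auto
  qed
qed

end
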